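(* Let $p \in [1,\infty)$. For any weighted composition operator $C_{w,f}$ on $C_0(\Omega)$, \[ N_p(C_{w,f}) = \sup_{N \in \mathbb{N}} \frac{1}{N} \sum_{n=1}^N \|w^{(n)}\|^p. \] In particular, $C_{w,f}$ is $p$-absolutely Cesàro bounded if and only if there exists a constant $C \in (0,\infty)$ such that \[ \frac{1}{N} \sum_{n=1}^N \|w^{(n)}\|^p \le C \quad \text{for all } N \in \mathbb{N}. \]
   Context: Fix $\mathbb{K} = \mathbb{R}$ or $\mathbb{C}$ and an arbitrary locally compact Hausdorff space $\Omega$. $C_0(\Omega)$ is the Banach space over $\mathbb{K}$ of all continuous maps $\varphi : \Omega \to \mathbb{K}$ vanishing at infinity, with norm $\|\varphi\| = \sup_{x\in\Omega} |\varphi(x)|$; the notation $\|\varphi\| = \sup_{x \in \Omega}|\varphi(x)|$ is used for any bounded $\varphi : \Omega \to \mathbb{K}$ (a supremum over the empty set is $0$). A weighted composition operator on $C_0(\Omega)$ is the map $C_{w,f}(\varphi) = (\varphi\circ f)\cdot w$, where $w : \Omega \to \mathbb{K}$ is continuous and bounded, $f : \Omega \to \Omega$ is continuous, and the set $\{x \in \Omega : f(x) \in K \text{ and } |w(x)| \ge \varepsilon\}$ is compact for every $\varepsilon > 0$ and every compact $K \subset \Omega$; these conditions make $C_{w,f}$ a well-defined bounded linear operator on $C_0(\Omega)$. Put $w^{(1)} = w$ and $w^{(n)} = (w\circ f^{n-1})\cdots(w\circ f)\cdot w$ for $n \ge 2$; $\mathbb{N} = \{1,2,\ldots\}$. An operator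 $T$ on a Banach space $Y$ is $p$-absolutely Cesàro bounded if there exists $C \in (0,\infty)$ such that $\sup_{N\in\mathbb{N}} \frac{1}{N}\sum_{n=1}^N \|T^n y\|^p \le C\|y\|^p$ for all $y \in Y$. One defines the extended real number $N_p(T) = \sup_{\|y\|=1}\sup_{N\in\mathbb{N}} \frac{1}{N}\sum_{n=1}^N \|T^n y\|^p \in [0,\infty]$ (suprema taken in $[0,\infty]$). *)

theory Defs
  imports "HOL-Analysis.Analysis"
begin

(* The space is a topology X on a carrier set rather than a type, so that the empty space is
   included.  The scalar field is any type of class real_normed_field; by the theorems of
   Ostrowski and Gelfand-Mazur such a field is isometrically isomorphic to the reals or to the
   complex numbers, and both are instances of the class. *)

text \<open>Supremum norm over the space, with value 0 on the empty space. It is meant for functions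
  that are bounded on the space (as a real supremum, it is unspecified otherwise).\<close>

definition supnorm :: "'a topology \<Rightarrow> ('a \<Rightarrow> 'k::real_normed_field) \<Rightarrow> real" where
  "supnorm X \<phi> = (if topspace X = {} then 0 else (SUP x\<in>topspace X. norm (\<phi> x)))"

text \<open>Functions on the space are represented by total functions that are extensional, that is,
  equal to \<open>undefined\<close> off the space, so that equality is equality of functions on the space.\<close>

definition C0 :: "'a topology \<Rightarrow> ('a \<Rightarrow> 'k::real_normed_field) set" where
  "C0 X = {\<phi> \<in> extensional (topspace X).
      continuous_map X euclidean \<phi> \<and>
      (\<forall>\<epsilon>>0. compactin X {x \<in> topspace X. norm (\<phi> x) \<ge> \<epsilon>})}"

definition admissible_weight ::
  "'a topology \<Rightarrow> ('a \<Rightarrow> 'k::real_normed_field) \<Rightarrow> ('a \<Rightarrow> 'a) \<Rightarrow> bool" where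
  "admissible_weight X w f \<longleftrightarrow>
      continuous_map X euclidean w \<and> bounded (w ` topspace X) \<and>
      continuous_map X X f \<and>
      (\<forall>\<epsilon>>0. \<forall>K. compactin X K \<longrightarrow>
         compactin X {x \<in> topspace X. f x \<in> K \<and> norm (w x) \<ge> \<epsilon>})"

definition weighted_comp ::
  "'a topology \<Rightarrow> ('a \<Rightarrow> 'k::real_normed_field) \<Rightarrow> ('a \<Rightarrow> 'a) \<Rightarrow> ('a \<Rightarrow> 'k) \<Rightarrow> ('a \<Rightarrow> 'k)" where
  "weighted_comp X w f \<phi> = (\<lambda>x\<in>topspace X. \<phi> (f x) * w x)"

definition iter_weight ::
  "('a \<Rightarrow> 'k::real_normed_field) \<Rightarrow> ('a \<Rightarrow> 'a) \<Rightarrow> nat \<Rightarrow> 'a \<Rightarrow> 'k" where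
  "iter_weight w f n x = (\<Prod>k<n. w ((f ^^ k) x))"

text \<open>In the next two definitions a Banach space is given by its carrier \<open>Y\<close> and its norm \<open>nrm\<close>,
  and \<open>T\<close> is an operator on it.\<close>

definition abs_cesaro_bounded :: "'v set \<Rightarrow> ('v \<Rightarrow> real) \<Rightarrow> real \<Rightarrow> ('v \<Rightarrow> 'v) \<Rightarrow> bool" where
  "abs_cesaro_bounded Y nrm p T \<longleftrightarrow>
     (\<exists>C::real. C > 0 \<and> (\<forall>y\<in>Y.
        (SUP N\<in>{1::nat..}. ennreal (1 / real N * (\<Sum>n=1..N. nrm ((T ^^ n) y) powr p)))
          \<le> ennreal (C * nrm y powr p)))"

definition cesaro_sup :: "'v set \<Rightarrow> ('v \<Rightarrow> real) \<Rightarrow> real \<Rightarrow> ('v \<Rightarrow> 'v) \<Rightarrow> ennreal" where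
  "cesaro_sup Y nrm p T =
     (SUP y\<in>{y \<in> Y. nrm y = 1}. SUP N\<in>{1::nat..}.
        ennreal (1 / real N * (\<Sum>n=1..N. nrm ((T ^^ n) y) powr p)))"

lemma C0_bounded:
  assumes "\<phi> \<in> C0 X"
  obtains M where "M > 0" "\<And>x. x \<in> topspace X \<Longrightarrow> norm (\<phi> x) \<le> M"
proof -
  have c: "continuous_map X euclidean \<phi>" "compactin X {x \<in> topspace X. norm (\<phi> x) \<ge> 1}"
    using assms by (auto simp: C0_def)
  have "compact (\<phi> ` {x \<in> topspace X. norm (\<phi> x) \<ge> 1})"
    using image_compactin[OF c(2,1)] by simp
  then obtain B where B: "\<forall>y \<in> \<phi> ` {x \<in> topspace X. norm (\<phi> x) \<ge> 1}. norm y \<le> B"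
    using compact_imp_bounded bounded_iff by metis
  have "norm (\<phi> x) \<le> max 1 B" if "x \<in> topspace X" for x
  proof (cases "norm (\<phi> x) \<ge> 1")
    case True
    then have "norm (\<phi> x) \<le> B"
      using B that by blast
    then show ?thesis by simp
  next
    case False
    then show ?thesis by simp
  qed
  then show thesis
    using that[of "max 1 B"] by simp
qed

lemma weighted_comp_in_C0:
  assumes "admissible_weight X w f" "\<phi> \<in> C0 X"
  shows "weighted_comp X w f \<phi> \<in> C0 X"
proof -
  have w: "continuous_map X euclidean w" and f: "continuous_map X X f"
    and \<phi>: "continuous_map X euclidean \<phi>"
    using assms by (auto simp: admissible_weight_def C0_def)
  have \<phi>f: "continuous_map X euclidean (\<lambda>x. \<phi> (f x))"
    using continuous_map_compose[OF f \<phi>] by (simp add: o_def)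
  have "continuous_map X euclidean (\<lambda>x. \<phi> (f x) * w x)"
    using \<phi>f w by (auto simp: continuous_map_atin intro!: tendsto_mult)
  then have cont: "continuous_map X euclidean (weighted_comp X w f \<phi>)"
    by (rule continuous_map_eq) (simp add: weighted_comp_def)
  obtain M where M: "M > 0" "\<And>x. x \<in> topspace X \<Longrightarrow> norm (\<phi> x) \<le> M"
    using C0_bounded[OF assms(2)] by blast
  obtain B where B: "B > 0" "\<And>x. x \<in> topspace X \<Longrightarrow> norm (w x) \<le> B"
    using assms(1) unfolding admissible_weight_def bounded_pos by auto
  have "compactin X {x \<in> topspace X. norm (weighted_comp X w f \<phi> x) \<ge> \<epsilon>}"
    if "\<epsilon> > 0" for \<epsilon>
  proof -
    define K where "K = {x \<in> topspace X. norm (\<phi> x) \<ge> \<epsilon> / B}"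
    have "compactin X K"
      using assms(2) \<open>\<epsilon> > 0\<close> B(1) by (simp add: C0_def K_def)
    then have comp: "compactin X {x \<in> topspace X. f x \<in> K \<and> norm (w x) \<ge> \<epsilon> / M}"
      using assms(1) \<open>\<epsilon> > 0\<close> M(1) by (simp add: admissible_weight_def)
    have "continuous_map X euclidean (\<lambda>x. norm (weighted_comp X w f \<phi> x))"
      by (rule continuous_map_norm[OF cont])
    from closedin_continuous_map_preimage[OF this, of "{\<epsilon>..}"]
    have clo: "closedin X {x \<in> topspace X. norm (weighted_comp X w f \<phi> x) \<ge> \<epsilon>}"
      by simp
    have "{x \<in> topspace X. norm (weighted_comp X w f \<phi> x) \<ge> \<epsilon>}
        \<subseteq> {x \<in> topspace X. f x \<in> K \<and> norm (w x) \<ge> \<epsilon> / M}"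
    proof clarify
      fix x assume x: "x \<in> topspace X" "norm (weighted_comp X w f \<phi> x) \<ge> \<epsilon>"
      have fx: "f x \<in> topspace X"
        using f x(1) by (auto simp: continuous_map_def)
      have le: "\<epsilon> \<le> norm (\<phi> (f x)) * norm (w x)"
        using x by (simp add: weighted_comp_def norm_mult)
      have "\<epsilon> \<le> norm (\<phi> (f x)) * B"
        using le mult_left_mono[OF B(2)[OF x(1)] norm_ge_zero[of "\<phi> (f x)"]] by linarith
      moreover have "\<epsilon> \<le> M * norm (w x)"
        using le mult_right_mono[OF M(2)[OF fx] norm_ge_zero[of "w x"]] by linarith
      ultimately show "f x \<in> K \<and> norm (w x) \<ge> \<epsilon> / M"
        using fx M(1) B(1) by (simp add: K_def field_simps)
    qed
    then show ?thesis
      using closed_compactin comp clo by blast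
  qed
  then show ?thesis
    using cont by (simp add: C0_def weighted_comp_def)
qed

end

theory Submission
  imports Defs
begin

text \<open>The powers of \<open>T = C\<^bsub>w,f\<^esub>\<close> are the weighted compositions given by the iterated weights \<open>w\<^sub>n\<close>
  and the iterates of \<open>f\<close>, so a unit vector \<open>\<phi>\<close> satisfies \<open>\<parallel>T\<^sup>n \<phi>\<parallel> \<le> \<parallel>w\<^sub>n\<parallel>\<close>. Conversely, given \<open>N\<close> and
  \<open>c < 1\<close>, choose for every \<open>n \<le> N\<close> a point \<open>x\<^sub>n\<close> with \<open>c \<parallel>w\<^sub>n\<parallel> \<le> \<bar>w\<^sub>n x\<^sub>n\<bar>\<close>. By Urysohn's lemma there is
  one unit vector \<open>\<phi>\<close> that is 1 at all the finitely many points \<open>f\<^sup>n x\<^sub>n\<close>, and then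
  \<open>\<parallel>T\<^sup>n \<phi>\<parallel> \<ge> c \<parallel>w\<^sub>n\<parallel>\<close> simultaneously for all \<open>n \<le> N\<close>. Let \<open>c\<close> tend to 1.\<close>

lemma supnorm_upper:
  assumes "bounded (\<phi> ` topspace X)" and "x \<in> topspace X"
  shows "norm (\<phi> x) \<le> supnorm X \<phi>"
proof -
  have "bdd_above ((\<lambda>x. norm (\<phi> x)) ` topspace X)"
    using assms(1) by (auto simp: bounded_iff bdd_above_def)
  then show ?thesis
    using assms(2) by (auto simp: supnorm_def intro: cSUP_upper2)
qed

lemma supnorm_least:
  assumes "\<And>x. x \<in> topspace X \<Longrightarrow> norm (\<phi> x) \<le> c" and "0 \<le> c"
  shows "supnorm X \<phi> \<le> c"
  using assms by (auto simp: supnorm_def intro: cSUP_least)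

lemma supnorm_nonneg:
  assumes "bounded (\<phi> ` topspace X)"
  shows "0 \<le> supnorm X \<phi>"
proof (cases "topspace X = {}")
  case False
  then obtain x where "x \<in> topspace X"
    by blast
  then show ?thesis
    using supnorm_upper[OF assms] norm_ge_zero order_trans by blast
qed (simp add: supnorm_def)

text \<open>A weight is merely bounded, so its norm need not be attained. The loss is taken as a
  factor \<open>c\<close>, not as an additive error, so that it can be pulled out of a
  power.\<close>

lemma supnorm_approx:
  assumes "topspace X \<noteq> {}" and "bounded (\<phi> ` topspace X)" and "c < 1"
  obtains x where "x \<in> topspace X" and "c * supnorm X \<phi> \<le> norm (\<phi> x)"
\<comment> \<open>For norm 0 the strict inequality used in the other case fails, but any point will
  do.\<close>
proof (cases "supnorm X \<phi> = 0")
  case True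
  moreover obtain x where "x \<in> topspace X"
    using assms(1) by blast
  ultimately show thesis
    using that by simp
next
  case False
  then have "c * supnorm X \<phi> < supnorm X \<phi>"
    using supnorm_nonneg[OF assms(2)] assms(3) by simp
  moreover have "bdd_above ((\<lambda>x. norm (\<phi> x)) ` topspace X)"
    using assms(2) by (auto simp: bounded_iff bdd_above_def)
  ultimately show thesis
    using assms(1) that less_cSUP_iff[of "topspace X" "\<lambda>x. norm (\<phi> x)" "c * supnorm X \<phi>"]
    by (auto simp: supnorm_def less_imp_le)
qed

lemma bounded_C0:
  assumes "\<phi> \<in> C0 X"
  shows "bounded (\<phi> ` topspace X)"
  using C0_bounded[OF assms] by (metis (no_types, lifting) bounded_iff imageE)

lemma admissible_weight_funpow_in:
  assumes "admissible_weight X w f" and "x \<in> topspace X"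
  shows "(f ^^ n) x \<in> topspace X"
  using assms by (induction n) (auto simp: admissible_weight_def continuous_map_def)

lemma bounded_iter_weight:
  assumes "admissible_weight X w f"
  shows "bounded (iter_weight w f n ` topspace X)"
proof -
  obtain B where "\<And>x. x \<in> topspace X \<Longrightarrow> norm (w x) \<le> B"
    using assms unfolding admissible_weight_def bounded_iff by auto
  then have "norm (iter_weight w f n x) \<le> (\<Prod>k<n. B)" if "x \<in> topspace X" for x
    unfolding iter_weight_def prod_norm[symmetric]
    using that by (intro prod_mono) (auto intro: admissible_weight_funpow_in[OF assms])
  then show ?thesis
    by (auto simp: bounded_iff)
qed

lemma weighted_comp_funpow_in_C0:
  assumes "admissible_weight X w f" and "\<phi> \<in> C0 X"
  shows "(weighted_comp X w f ^^ n) \<phi> \<in> C0 X"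
  by (induction n) (use assms weighted_comp_in_C0 in auto)

lemma weighted_comp_funpow:
  assumes "admissible_weight X w f" and "x \<in> topspace X"
  shows "(weighted_comp X w f ^^ n) \<phi> x = \<phi> ((f ^^ n) x) * iter_weight w f n x"
  using assms(2)
\<comment> \<open>Peeling off the outermost application leads to the induction hypothesis at
  \<open>f x\<close>; the factor \<open>w x\<close> is the term \<open>k = 0\<close> of the
  product.\<close>
proof (induction n arbitrary: x)
  case 0
  then show ?case
    by (simp add: iter_weight_def)
next
  case (Suc n)
  then have "f x \<in> topspace X"
    using admissible_weight_funpow_in[OF assms(1), of x 1] by simp
  then show ?case
    using Suc
    by (simp add: weighted_comp_def iter_weight_def prod.lessThan_Suc_shift funpow_swap1 mult_ac
        del: prod.lessThan_Suc)
qed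

lemma supnorm_weighted_comp_funpow_le:
  assumes "admissible_weight X w f" and "\<phi> \<in> C0 X"
  shows "supnorm X ((weighted_comp X w f ^^ n) \<phi>) \<le> supnorm X (iter_weight w f n) * supnorm X \<phi>"
proof (rule supnorm_least)
  note bounded = bounded_iter_weight[OF assms(1), of n] bounded_C0[OF assms(2)]
  fix x assume x: "x \<in> topspace X"
  then show "norm ((weighted_comp X w f ^^ n) \<phi> x) \<le> supnorm X (iter_weight w f n) * supnorm X \<phi>"
    unfolding weighted_comp_funpow[OF assms(1) x] norm_mult
    by (subst mult.commute, intro mult_mono supnorm_upper supnorm_nonneg bounded
        admissible_weight_funpow_in[OF assms(1)]) simp_all
qed (intro mult_nonneg_nonneg supnorm_nonneg bounded_iter_weight bounded_C0 assms)

text \<open>Provides the test functions. A whole compact set \<open>K\<close>, not just one point,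
  is allowed so that a single function can serve all terms of a Cesaro sum.\<close>

lemma C0_unit_vector_eq_1_on_compact:
  assumes "locally_compact_space X" and "Hausdorff_space X" and "compactin X K" and "K \<noteq> {}"
  obtains \<phi> :: "'a \<Rightarrow> 'k::real_normed_field"
    where "\<phi> \<in> C0 X" and "supnorm X \<phi> = 1" and "\<And>x. x \<in> K \<Longrightarrow> \<phi> x = 1"
proof -
  have reg: "regular_space X"
    using assms locally_compact_Hausdorff_imp_regular_space by blast
  obtain U L where UL: "openin X U" "compactin X L" "closedin X L" "K \<subseteq> U" "U \<subseteq> L"
    using locally_compact_space_compact_closed_compact[of X] assms by metis
  \<comment> \<open>The space need not be normal, but complete regularity suffices to separate a
    compact set from a closed one.\<close>
  have cr: "completely_regular_space X"
    using locally_compact_regular_imp_completely_regular_space assms(1) reg by blast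
  have "closedin X (topspace X - U)" "disjnt K (topspace X - U)"
    using UL by (auto simp: disjnt_def)
  then obtain g where g: "continuous_map X (top_of_set {0..1::real}) g"
    "g ` (topspace X - U) \<subseteq> {0}" "g ` K \<subseteq> {1}"
    using Urysohn_completely_regular_compact_closed[of 0 1 X K "topspace X - U"] cr assms(3)
    by auto
  have KX: "K \<subseteq> topspace X"
    using assms(3) compactin_subset_topspace by blast
  have g_cont: "continuous_map X euclideanreal g"
    and g_range: "\<And>x. x \<in> topspace X \<Longrightarrow> 0 \<le> g x \<and> g x \<le> 1"
    using g(1) by (auto simp: continuous_map_in_subtopology)
  define \<phi> :: "'a \<Rightarrow> 'k" where "\<phi> = (\<lambda>x\<in>topspace X. of_real (g x))"
  have norm_\<phi>: "norm (\<phi> x) = g x" if "x \<in> topspace X" for x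
    using g_range that by (simp add: \<phi>_def)
  have "continuous_map X euclidean (\<lambda>x. of_real (g x) :: 'k)"
    using g_cont by (auto simp: continuous_map_atin intro!: tendsto_of_real)
  then have \<phi>_cont: "continuous_map X euclidean \<phi>"
    by (rule continuous_map_eq) (simp add: \<phi>_def)
  have "compactin X {x \<in> topspace X. norm (\<phi> x) \<ge> \<epsilon>}" if "\<epsilon> > 0" for \<epsilon>
  proof (rule closed_compactin[OF UL(2)])
    \<comment> \<open>Off \<open>U\<close> the function vanishes, and \<epsilon> is
      positive.\<close>
    show "{x \<in> topspace X. norm (\<phi> x) \<ge> \<epsilon>} \<subseteq> L"
      using g(2) UL(5) that norm_\<phi> by fastforce
    show "closedin X {x \<in> topspace X. norm (\<phi> x) \<ge> \<epsilon>}"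
      using closedin_continuous_map_preimage[OF continuous_map_norm[OF \<phi>_cont], of "{\<epsilon>..}"] by simp
  qed
  then have \<phi>: "\<phi> \<in> C0 X"
    using \<phi>_cont by (simp add: C0_def \<phi>_def)
  have \<phi>_K: "\<phi> x = 1" if "x \<in> K" for x
    using g(3) KX that by (auto simp: \<phi>_def)
  obtain x where "x \<in> K"
    using assms(4) by blast
  then have "1 \<le> supnorm X \<phi>"
    using supnorm_upper[OF bounded_C0[OF \<phi>], of x] \<phi>_K KX by auto
  moreover have "supnorm X \<phi> \<le> 1"
    using g_range norm_\<phi> by (intro supnorm_least) auto
  ultimately show thesis
    using that \<phi> \<phi>_K by force
qed

text \<open>The order of choice is what matters: the near-maximal points for all \<open>n\<close> up
  to \<open>N\<close> come first, then one \<phi> that equals 1 at all their images, so the whole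
  sum is tested by the same unit vector.\<close>

lemma sum_iter_weight_le:
  fixes w :: "'a \<Rightarrow> 'k::real_normed_field"
  assumes "locally_compact_space X" and "Hausdorff_space X" and adm: "admissible_weight X w f"
    and p: "0 < p" and "0 \<le> L"
    and bound: "\<And>\<phi>. \<phi> \<in> C0 X \<Longrightarrow> supnorm X \<phi> = 1 \<Longrightarrow>
      (\<Sum>n=1..N. supnorm X ((weighted_comp X w f ^^ n) \<phi>) powr p) \<le> L"
  shows "(\<Sum>n=1..N. supnorm X (iter_weight w f n) powr p) \<le> L"
\<comment> \<open>The sum is 0 in both degenerate cases. Otherwise the points \<open>x n\<close>
  exist and \<open>K\<close> below is nonempty.\<close>
proof (cases "topspace X = {} \<or> N = 0")
  case True
  then show ?thesis
    using p \<open>0 \<le> L\<close> by (auto simp: supnorm_def)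
next
  case False
  note w_bounded = bounded_iter_weight[OF adm]
  show ?thesis
  proof (rule field_le_mult_one_interval)
    fix z :: real assume z: "0 < z" "z < 1"
    \<comment> \<open>Chosen so that the loss \<open>c\<close> in each norm becomes exactly the
      factor \<open>z\<close> after raising to the power \<open>p\<close>.\<close>
    define c where "c = z powr (1 / p)"
    have c: "0 < c" "c < 1" "c powr p = z"
      using z p powr_less_mono2[of "1 / p" z 1] by (auto simp: c_def powr_powr)
    have "\<exists>x. x \<in> topspace X \<and> c * supnorm X (iter_weight w f n) \<le> norm (iter_weight w f n x)" for n
      using supnorm_approx[OF _ w_bounded c(2)] False by metis
    then obtain x where x: "\<And>n. x n \<in> topspace X"
      "\<And>n. c * supnorm X (iter_weight w f n) \<le> norm (iter_weight w f n (x n))"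
      by metis
    define K where "K = (\<lambda>n. (f ^^ n) (x n)) ` {1..N}"
    have "compactin X K" "K \<noteq> {}"
      using False x(1) admissible_weight_funpow_in[OF adm]
      by (auto simp: K_def intro!: finite_imp_compactin)
    then obtain \<phi> :: "'a \<Rightarrow> 'k" where \<phi>: "\<phi> \<in> C0 X" "supnorm X \<phi> = 1" "\<And>y. y \<in> K \<Longrightarrow> \<phi> y = 1"
      using C0_unit_vector_eq_1_on_compact[OF assms(1,2)] by metis
    have lower: "c * supnorm X (iter_weight w f n) \<le> supnorm X ((weighted_comp X w f ^^ n) \<phi>)"
      if "n \<in> {1..N}" for n
    proof -
      \<comment> \<open>The factor of \<phi> is 1 here, since \<open>(f ^^ n) (x n)\<close> lies in
        \<open>K\<close>.\<close>
      have "norm ((weighted_comp X w f ^^ n) \<phi> (x n)) = norm (iter_weight w f n (x n))"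
        using \<phi>(3) that by (simp add: weighted_comp_funpow[OF adm x(1)] K_def)
      then show ?thesis
        using x(2)[of n] supnorm_upper[OF bounded_C0 x(1)[of n]]
          weighted_comp_funpow_in_C0[OF adm \<phi>(1), of n]
        by (metis order_trans)
    qed
    have "z * (\<Sum>n=1..N. supnorm X (iter_weight w f n) powr p)
        = (\<Sum>n=1..N. (c * supnorm X (iter_weight w f n)) powr p)"
      using c supnorm_nonneg[OF w_bounded] by (simp add: sum_distrib_left powr_mult)
    also have "\<dots> \<le> (\<Sum>n=1..N. supnorm X ((weighted_comp X w f ^^ n) \<phi>) powr p)"
      using c p supnorm_nonneg[OF w_bounded] lower by (intro sum_mono powr_mono2) auto
    also have "\<dots> \<le> L"
      by (rule bound[OF \<phi>(1,2)])
    finally show "z * (\<Sum>n=1..N. supnorm X (iter_weight w f n) powr p) \<le> L" .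
  qed
qed

text \<open>Keeping the norm of \<phi> as a factor lets the estimate serve both the supremum over
  unit vectors and the bound for arbitrary \<phi>.\<close>

lemma sum_weighted_comp_funpow_le:
  assumes adm: "admissible_weight X w f" and \<phi>: "\<phi> \<in> C0 X" and "0 \<le> p"
  shows "(\<Sum>n=1..N. supnorm X ((weighted_comp X w f ^^ n) \<phi>) powr p)
    \<le> (\<Sum>n=1..N. supnorm X (iter_weight w f n) powr p) * supnorm X \<phi> powr p"
proof -
  have "(\<Sum>n=1..N. supnorm X ((weighted_comp X w f ^^ n) \<phi>) powr p)
      \<le> (\<Sum>n=1..N. (supnorm X (iter_weight w f n) * supnorm X \<phi>) powr p)"
    using assms supnorm_weighted_comp_funpow_le[OF adm \<phi>]
    by (intro sum_mono powr_mono2 supnorm_nonneg bounded_C0 weighted_comp_funpow_in_C0)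
  then show ?thesis
    using supnorm_nonneg[OF bounded_iter_weight[OF adm]] supnorm_nonneg[OF bounded_C0[OF \<phi>]]
    by (simp add: powr_mult sum_distrib_right)
qed

theorem theorem62:
  fixes \<Omega> :: "'a topology"
    and w :: "'a \<Rightarrow> 'k::real_normed_field"
    and f :: "'a \<Rightarrow> 'a"
    and p :: real
  assumes "locally_compact_space \<Omega>" and "Hausdorff_space \<Omega>"
    and "admissible_weight \<Omega> w f"
    and "1 \<le> p"
  shows "cesaro_sup (C0 \<Omega>) (supnorm \<Omega>) p (weighted_comp \<Omega> w f) =
           (SUP N\<in>{1::nat..}. ennreal (1 / real N * (\<Sum>n=1..N. supnorm \<Omega> (iter_weight w f n) powr p)))
       \<and> (abs_cesaro_bounded (C0 \<Omega>) (supnorm \<Omega>) p (weighted_comp \<Omega> w f) \<longleftrightarrow>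
           (\<exists>C::real. C > 0 \<and>
              (\<forall>N\<ge>1. 1 / real N * (\<Sum>n=1..N. supnorm \<Omega> (iter_weight w f n) powr p) \<le> C)))"
proof -
  define A where "A N = 1 / real N * (\<Sum>n=1..N. supnorm \<Omega> (iter_weight w f n) powr p)" for N
  define B where "B \<phi> N = 1 / real N *
    (\<Sum>n=1..N. supnorm \<Omega> ((weighted_comp \<Omega> w f ^^ n) \<phi>) powr p)" for \<phi> N
  note defs = cesaro_sup_def abs_cesaro_bounded_def A_def[symmetric] B_def[symmetric]
  have B_le: "B \<phi> N \<le> A N * supnorm \<Omega> \<phi> powr p" if "\<phi> \<in> C0 \<Omega>" for \<phi> N
    using mult_left_mono[OF sum_weighted_comp_funpow_le[OF assms(3) that, of p N], of "1 / real N"]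
      assms(4) by (simp add: A_def B_def)
  \<comment> \<open>Multiplying by \<open>N\<close> turns the bound on means into the bound
    \<open>real N * L\<close> on sums.\<close>
  have A_le: "A N \<le> L"
    if "N \<ge> 1" "0 \<le> L" "\<And>\<phi>. \<phi> \<in> C0 \<Omega> \<Longrightarrow> supnorm \<Omega> \<phi> = 1 \<Longrightarrow> B \<phi> N \<le> L" for N L
    using sum_iter_weight_le[OF assms(1-3), of p "real N * L" N] assms(4) that
    by (simp add: A_def B_def field_simps)
  let ?S = "SUP \<phi>\<in>{\<phi> \<in> C0 \<Omega>. supnorm \<Omega> \<phi> = 1}. SUP N\<in>{1::nat..}. ennreal (B \<phi> N)"
  have "?S = (SUP N\<in>{1::nat..}. ennreal (A N))"
  proof (rule antisym)
    show "?S \<le> (SUP N\<in>{1..}. ennreal (A N))"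
      using B_le by (intro SUP_least SUP_upper2 ennreal_leI) force+
    show "(SUP N\<in>{1..}. ennreal (A N)) \<le> ?S"
    \<comment> \<open>Only a finite supremum needs an argument: its real value \<open>L\<close> then
      bounds the means of every unit vector.\<close>
    proof (cases "?S")
      case (real L)
      have "B \<phi> N \<le> L" if "\<phi> \<in> C0 \<Omega>" "supnorm \<Omega> \<phi> = 1" "N \<ge> 1" for \<phi> N
      proof -
        have "ennreal (B \<phi> N) \<le> ?S"
          using that by (intro SUP_upper2[of \<phi>] SUP_upper) auto
        then show ?thesis
          using real by simp
      qed
      then show ?thesis
        unfolding real(2) using real(1) by (intro SUP_least ennreal_leI A_le) auto
    next
      case top
      show ?thesis
        unfolding top by (rule top_greatest)
    qed
  qed
  \<comment> \<open>The same constant \<open>C\<close> works in both directions: restrict to unit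
    vectors and apply \<open>A_le\<close>, or conversely scale by \<open>B_le\<close>.\<close>
  moreover have "(\<exists>C>0. \<forall>\<phi>\<in>C0 \<Omega>. (SUP N\<in>{1..}. ennreal (B \<phi> N)) \<le> ennreal (C * supnorm \<Omega> \<phi> powr p))
    \<longleftrightarrow> (\<exists>C>0. \<forall>N\<ge>1. A N \<le> C)"
  proof (intro iffI; elim exE conjE)
    fix C :: real
    assume C: "C > 0"
      "\<forall>\<phi>\<in>C0 \<Omega>. (SUP N\<in>{1..}. ennreal (B \<phi> N)) \<le> ennreal (C * supnorm \<Omega> \<phi> powr p)"
    have "B \<phi> N \<le> C" if "\<phi> \<in> C0 \<Omega>" "supnorm \<Omega> \<phi> = 1" "N \<ge> 1" for \<phi> N
    proof -
      have "(SUP N\<in>{1..}. ennreal (B \<phi> N)) \<le> ennreal C"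
        using C(2) that by fastforce
      then show ?thesis
        using C(1) that(3) by (simp add: SUP_le_iff)
    qed
    then show "\<exists>C>0. \<forall>N\<ge>1. A N \<le> C"
      using C(1) by (intro exI[of _ C] conjI allI impI A_le) auto
  next
    fix C :: real
    assume C: "C > 0" "\<forall>N\<ge>1. A N \<le> C"
    have "B \<phi> N \<le> C * supnorm \<Omega> \<phi> powr p" if "\<phi> \<in> C0 \<Omega>" "N \<ge> 1" for \<phi> N
      using B_le[OF that(1)] C(2) that(2) mult_right_mono[of "A N" C "supnorm \<Omega> \<phi> powr p"]
      by (meson order_trans powr_ge_zero)
    then show "\<exists>C>0. \<forall>\<phi>\<in>C0 \<Omega>. (SUP N\<in>{1..}. ennreal (B \<phi> N)) \<le> ennreal (C * supnorm \<Omega> \<phi> powr p)"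
      using C(1) by (intro exI[of _ C] conjI ballI SUP_least ennreal_leI) auto
  qed
  ultimately show ?thesis
    unfolding defs by blast
qed

end
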